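(* For all integers $n,r\ge 0$ and $\lambda\ge 1$, $$\tilde T_r^\lambda(n)=\sum_{k=0}^{n}\binom{n}{k}\,\mathcal{B}_0^r(k)\,\mathcal{D}_{2,0}^\lambda(n-k).$$
   Context: The numbers $\mathcal{B}_0^r(k)$ are defined by $\sum_{k\ge 0}\mathcal{B}_0^r(k)\frac{z^k}{k!}=\exp[r(e^z-1)]$. The Dowling polynomials $\mathcal{D}_{2,0}^\lambda(n)$ are defined by $\sum_{n\ge 0}\mathcal{D}_{2,0}^\lambda(n)\frac{z^n}{n!}=\exp\!\left[\frac{\lambda(e^{2z}-1)}{2}\right]$. For integers $n,r\ge 0$ and $\lambda\ge 1$, $\tilde T_r^\lambda(n)$ denotes the number of configurations on $[n+r]=\{1,\dots,n+r\}$ of the following kind: the first $r$ elements form $r$ distinct singleton blocks (the distinguished blocks); the elements $r+1,\dots,n+r$ are partitioned into $k$ non-empty subsets, where $k$ runs over $0,\dots,n$ (all $k$ are counted); each of these $k$ subsets either is placed into one of $\lambda$ labelled sections or is paired with one of the $r$ distinguished blocks, where each distinguished block may be paired with any number (possibly zero, possibly several) of subsets; and, among the subsets placed in the same section, each subset is either paired with exactly one other subset of that section or is not paired at all (i.e. a matching on the subsets in each section). Subsets within a section are unordered. *)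

theory Defs
  imports Complex_Main "HOL-Library.FuncSet" "HOL-Library.Disjoint_Sets"
    "HOL-Computational_Algebra.Formal_Power_Series"
begin

definition B0_egf :: "nat \<Rightarrow> real fps" where
  "B0_egf r = fps_exp 1 oo (fps_const (real r) * (fps_exp 1 - 1))"

definition B0 :: "nat \<Rightarrow> nat \<Rightarrow> real" where
  "B0 r k = fact k * fps_nth (B0_egf r) k"

definition D20_egf :: "real \<Rightarrow> real fps" where
  "D20_egf x = fps_exp 1 oo (fps_const (x / 2) * (fps_exp 2 - 1))"

definition D20 :: "real \<Rightarrow> nat \<Rightarrow> real" where
  "D20 x n = fact n * fps_nth (D20_egf x) n"

lemma B0_generating_function: "Abs_fps (\<lambda>k. B0 r k / fact k) = B0_egf r"
  by (simp add: fps_eq_iff B0_def)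

lemma D20_generating_function: "Abs_fps (\<lambda>n. D20 x n / fact n) = D20_egf x"
  by (simp add: fps_eq_iff D20_def)

text \<open>A section is given by its label, a distinguished block by the block itself.\<close>

datatype place = Section nat | Distinguished "nat set"

definition distinguished_blocks :: "nat \<Rightarrow> nat set set" where
  "distinguished_blocks r = (\<lambda>i. {i}) ` {1..r}"

definition places :: "nat \<Rightarrow> nat \<Rightarrow> place set" where
  "places r l = Section ` {1..l} \<union> Distinguished ` distinguished_blocks r"

text \<open>The edges of the matching are the pairs of subsets; a subset in no edge is not paired with
  another one. Only subsets lying in a common section may form an edge.\<close>

definition section_matching ::
    "nat \<Rightarrow> nat set set \<Rightarrow> (nat set \<Rightarrow> place) \<Rightarrow> nat set set set \<Rightarrow> bool" where
  "section_matching l P f M \<longleftrightarrow>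
     (\<forall>e\<in>M. e \<subseteq> P \<and> card e = 2 \<and> (\<exists>s\<in>{1..l}. \<forall>X\<in>e. f X = Section s)) \<and> disjoint M"

text \<open>A configuration is a triple of the partition \<open>P\<close> of \<open>{r+1..n+r}\<close>, the map \<open>f\<close>
  giving the place of each subset in \<open>P\<close>, and the matching \<open>M\<close>. The number of subsets
  is not fixed; it automatically lies between 0 and \<open>n\<close>.\<close>

definition configurations ::
    "nat \<Rightarrow> nat \<Rightarrow> nat \<Rightarrow> (nat set set \<times> (nat set \<Rightarrow> place) \<times> nat set set set) set" where
  "configurations n r l =
     {(P, f, M). partition_on {r+1..n+r} P \<and> f \<in> P \<rightarrow>\<^sub>E places r l \<and> section_matching l P f M}"

definition T_count :: "nat \<Rightarrow> nat \<Rightarrow> nat \<Rightarrow> nat" where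
  "T_count n r l = card (configurations n r l)"

lemma finite_configurations: "finite (configurations n r l)"
proof -
  let ?A = "Pow {r+1..n+r}"
  let ?F = "\<Union>P\<in>Pow ?A. P \<rightarrow>\<^sub>E places r l"
  have "finite (places r l)"
    by (simp add: places_def distinguished_blocks_def)
  moreover have "finite P" if "P \<in> Pow ?A" for P
    using that finite_subset[of P ?A] by simp
  ultimately have F: "finite ?F"
    by (intro finite_UN_I finite_PiE) simp_all
  have "configurations n r l \<subseteq> Pow ?A \<times> ?F \<times> Pow (Pow ?A)"
  proof
    fix c assume "c \<in> configurations n r l"
    then obtain P f M where c: "c = (P, f, M)" "partition_on {r+1..n+r} P"
        "f \<in> P \<rightarrow>\<^sub>E places r l" "section_matching l P f M"
      by (auto simp: configurations_def)
    have P: "P \<in> Pow ?A"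
      using c(2) unfolding partition_on_def by blast
    have "M \<subseteq> Pow P"
      using c(4) unfolding section_matching_def by blast
    also have "\<dots> \<subseteq> Pow ?A"
      using P by (intro Pow_mono) simp
    finally have "M \<in> Pow (Pow ?A)"
      by simp
    moreover have "f \<in> ?F"
      using P c(3) by (rule UN_I)
    ultimately show "c \<in> Pow ?A \<times> ?F \<times> Pow (Pow ?A)"
      unfolding c(1) using P by (intro SigmaI)
  qed
  moreover have "finite (Pow ?A \<times> ?F \<times> Pow (Pow ?A))"
    using F by (intro finite_cartesian_product) simp_all
  ultimately show ?thesis
    by (rule finite_subset)
qed

lemma card_partition_le:
  assumes "(P, f, M) \<in> configurations n r l"
  shows "card P \<le> n"
proof -
  have P: "partition_on {r+1..n+r} P"
    using assms by (simp add: configurations_def)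
  have sub: "X \<subseteq> {r+1..n+r} \<and> X \<noteq> {}" if "X \<in> P" for X
    using P that unfolding partition_on_def by blast
  have "card P = (\<Sum>X\<in>P. 1)"
    by simp
  also have "\<dots> \<le> (\<Sum>X\<in>P. card X)"
  proof (rule sum_mono)
    fix X assume "X \<in> P"
    then have "finite X" "X \<noteq> {}"
      using sub[of X] finite_subset by auto
    then show "1 \<le> card X"
      by (simp add: Suc_le_eq card_gt_0_iff)
  qed
  also have "\<dots> = card (\<Union>P)"
    using sub P finite_subset[of _ "{r+1..n+r}"]
    by (subst card_Union_disjoint)
      (auto simp: partition_on_def disjoint_def pairwise_def disjnt_def)
  also have "\<dots> = n"
    using P by (simp add: partition_on_def)
  finally show ?thesis .
qed

end

theory Submission imports Defs begin

text \<open>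
  Cut a configuration into its \<^emph>\<open>components\<close>: a component is either one subset that is not
  matched with another subset, or two subsets joined by an edge of the matching, together with the
  place it occupies; all subsets in a component share that place. The components of a
  configuration have disjoint supports that cover the ground set, and conversely every such family of
  components comes from exactly one configuration (\<open>components_of_bij_betw\<close>).

  Consequently the exponential formula applies. If \<open>T\<close> counts families of components and
  \<open>w k\<close> is the number of components supported on a given set of \<open>k + 1\<close> points, then singling out
  the component that contains one chosen point gives
  \<open>T (n + 1) = (\<Sum>k\<le>n. (n choose k) * w k * T (n - k))\<close>. In terms of exponential generating
  functions this is the differential equation \<open>F' = F * G\<close>, where \<open>G\<close> is the generating function
  of \<open>w\<close>, and the equation together with the initial value 1 determines \<open>F\<close>
  (\<open>exponential_formula\<close>).

  A component on \<open>k + 1\<close> points is a single subset in one of \<open>r\<close> distinguished places, or a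
  partition of the points into one or two subsets in one of \<open>l\<close> sections. There are \<open>2 ^ k\<close> such
  partitions, since the subset containing a fixed point may be chosen freely, so
  \<open>w k = r + l * 2 ^ k\<close> (\<open>card_components\<close>) and \<open>G = r * exp z + l * exp (2 * z)\<close>. The two
  summands are the logarithmic derivatives of the generating functions of \<open>B0 r\<close> and
  \<open>D20 l\<close>, so \<open>F\<close> is the product of these two, and comparing coefficients gives the claim.
\<close>

section \<open>The exponential formula for set assemblies\<close>

definition assemblies :: "'c set \<Rightarrow> ('c \<Rightarrow> 'a set) \<Rightarrow> 'a set \<Rightarrow> 'c set set" where
  "assemblies K supp A = {C. C \<subseteq> K \<and> disjoint_family_on supp C \<and> (\<Union>c\<in>C. supp c) = A}"

lemma finite_assemblies:
  assumes "finite A" and "\<And>S. finite S \<Longrightarrow> finite {c\<in>K. supp c = S}"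
  shows "finite (assemblies K supp A)"
proof -
  have "finite (\<Union>S\<in>Pow A. {c\<in>K. supp c = S})"
    using assms(1) by (intro finite_UN_I assms(2)) (auto intro: finite_subset)
  moreover have "assemblies K supp A \<subseteq> Pow (\<Union>S\<in>Pow A. {c\<in>K. supp c = S})"
    unfolding assemblies_def by auto
  ultimately show ?thesis
    by (meson finite_Pow_iff finite_subset)
qed

lemma assemblies_empty:
  assumes "\<And>c. c \<in> K \<Longrightarrow> supp c \<noteq> {}"
  shows "assemblies K supp {} = {{}}"
proof -
  have "C = {}" if "C \<subseteq> K" "(\<Union>c\<in>C. supp c) = {}" for C
    using that assms by blast
  then show ?thesis unfolding assemblies_def by (auto simp: disjoint_family_on_def)
qed

text \<open>An assembly on \<open>insert a A\<close> is its component \<open>c\<close> containing \<open>a\<close>, followed by an arbitrary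
  assembly on the points of \<open>A\<close> not used by \<open>c\<close>; the sum runs over the other points of \<open>c\<close>.\<close>

lemma card_assemblies_insert:
  assumes A: "finite A" "a \<notin> A"
    and ne: "\<And>c. c \<in> K \<Longrightarrow> supp c \<noteq> {}"
    and fin: "\<And>S. finite S \<Longrightarrow> finite {c\<in>K. supp c = S}"
  shows "card (assemblies K supp (insert a A)) =
    (\<Sum>S\<in>Pow A. card {c\<in>K. supp c = insert a S} * card (assemblies K supp (A - S)))"
proof -
  let ?D = "SIGMA S:Pow A. {c\<in>K. supp c = insert a S} \<times> assemblies K supp (A - S)"
  let ?g = "\<lambda>(S, c, D). insert c D"
  have "bij_betw ?g ?D (assemblies K supp (insert a A))"
  proof (rule bij_betw_imageI)
    \<comment> \<open>The component \<open>c\<close> can be read off \<open>insert c D\<close>, as it alone has \<open>a\<close> in its support.\<close>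
    have key: "S = S' \<and> c = c' \<and> D = D'"
      if 1: "S \<subseteq> A" "supp c = insert a S" "D \<in> assemblies K supp (A - S)"
        and 2: "S' \<subseteq> A" "supp c' = insert a S'" "D' \<in> assemblies K supp (A - S')"
        and eq: "insert c D = insert c' D'" for S c D S' c' D'
    proof -
      have D: "a \<notin> supp d" if "d \<in> D" for d
        using that 1(3) A(2) unfolding assemblies_def by auto
      have D': "a \<notin> supp d" if "d \<in> D'" for d
        using that 2(3) A(2) unfolding assemblies_def by auto
      have "c \<in> insert c' D'" using eq by auto
      then have c: "c = c'" using D' 1(2) by auto
      have "c \<notin> D" "c \<notin> D'" using D D' 1(2) by auto
      with eq c have "D = D'" by auto
      moreover have "S = S'" using c 1 2 A(2) by (metis insert_ident subsetD)
      ultimately show ?thesis using c by simp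
    qed
    show "inj_on ?g ?D"
    proof (rule inj_onI)
      fix x y assume "x \<in> ?D" "y \<in> ?D" "?g x = ?g y"
      then show "x = y"
        using key[of "fst x" "fst (snd x)" "snd (snd x)" "fst y" "fst (snd y)" "snd (snd y)"]
        by (cases x; cases y) simp
    qed
  next
    show "?g ` ?D = assemblies K supp (insert a A)"
    proof (rule equalityI; rule subsetI)
      fix C assume "C \<in> ?g ` ?D"
      then obtain S c D where *: "S \<subseteq> A" "c \<in> K" "supp c = insert a S"
          "D \<in> assemblies K supp (A - S)" "C = insert c D"
        by auto
      have "supp d \<inter> supp c = {}" if "d \<in> D" for d
        using that * A(2) unfolding assemblies_def by auto
      then show "C \<in> assemblies K supp (insert a A)"
        using * unfolding assemblies_def disjoint_family_on_def by auto
    next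
      fix C assume C: "C \<in> assemblies K supp (insert a A)"
      then obtain c where c: "c \<in> C" "a \<in> supp c"
        unfolding assemblies_def by blast
      have cK: "c \<in> K" "supp c \<subseteq> insert a A" using C c unfolding assemblies_def by auto
      let ?S = "supp c - {a}"
      have dj: "supp d \<inter> supp c = {}" if "d \<in> C - {c}" for d
        using that C c(1) unfolding assemblies_def disjoint_family_on_def by auto
      have "(\<Union>d\<in>C - {c}. supp d) = (\<Union>d\<in>C. supp d) - supp c"
        using dj by blast
      also have "\<dots> = insert a A - supp c"
        using C unfolding assemblies_def by simp
      also have "\<dots> = A - ?S" using c(2) A(2) by auto
      finally have "C - {c} \<in> assemblies K supp (A - ?S)"
        using C unfolding assemblies_def disjoint_family_on_def by auto
      then have "(?S, c, C - {c}) \<in> ?D" using c cK by auto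
      moreover have "C = ?g (?S, c, C - {c})" using c(1) by auto
      ultimately show "C \<in> ?g ` ?D" by (rule rev_image_eqI)
    qed
  qed
  then have "card (assemblies K supp (insert a A)) = card ?D"
    by (simp add: bij_betw_same_card)
  also have "\<dots> = (\<Sum>S\<in>Pow A. card ({c\<in>K. supp c = insert a S} \<times> assemblies K supp (A - S)))"
  proof (rule card_SigmaI)
    show "finite (Pow A)" using A(1) by simp
    show "\<forall>S\<in>Pow A. finite ({c\<in>K. supp c = insert a S} \<times> assemblies K supp (A - S))"
    proof
      fix S assume "S \<in> Pow A"
      then have "finite (insert a S)" using A(1) by (auto intro: finite_subset)
      then show "finite ({c\<in>K. supp c = insert a S} \<times> assemblies K supp (A - S))"
        using fin A(1) by (intro finite_cartesian_product finite_assemblies) auto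
    qed
  qed
  finally show ?thesis by (simp add: card_cartesian_product)
qed

lemma sum_Pow_card:
  fixes f :: "nat \<Rightarrow> real"
  assumes "finite A"
  shows "(\<Sum>S\<in>Pow A. f (card S)) = (\<Sum>k=0..card A. real (card A choose k) * f k)"
proof -
  have "(\<Sum>S\<in>Pow A. f (card S)) = (\<Sum>k\<in>{0..card A}. \<Sum>S\<in>{S \<in> Pow A. card S = k}. f (card S))"
    by (rule sum.group[symmetric]) (use assms in \<open>auto intro: card_mono\<close>)
  also have "\<dots> = (\<Sum>k=0..card A. real (card A choose k) * f k)"
    using assms by (intro sum.cong) (simp_all add: n_subsets[symmetric])
  finally show ?thesis .
qed

text \<open>The recursion of \<open>card_assemblies_insert\<close> is, coefficient by coefficient, the equation
  \<open>F' = F * G\<close>. The formula is stated through this equation rather than through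
  \<open>F = exp W\<close> with \<open>W' = G\<close>, because the equation is easy to verify when \<open>F\<close> is
  given as a product of exponentials.\<close>

theorem exponential_formula:
  fixes F G :: "real fps"
  assumes "finite A"
    and ne: "\<And>c. c \<in> K \<Longrightarrow> supp c \<noteq> {}"
    and fin: "\<And>S. finite S \<Longrightarrow> finite {c\<in>K. supp c = S}"
    and comp: "\<And>a S. finite S \<Longrightarrow> a \<notin> S \<Longrightarrow>
      real (card {c\<in>K. supp c = insert a S}) = fact (card S) * fps_nth G (card S)"
    and F0: "fps_nth F 0 = 1" and ode: "fps_deriv F = F * G"
  shows "real (card (assemblies K supp A)) = fact (card A) * fps_nth F (card A)"
  using \<open>finite A\<close>
proof (induction "card A" arbitrary: A rule: less_induct)
  case less
  show ?case
  proof (cases "A = {}")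
    case True
    then show ?thesis using F0 ne by (simp add: assemblies_empty)
  next
    case False
    then obtain a B where A: "A = insert a B" and aB: "a \<notin> B" by (meson Set.set_insert ex_in_conv)
    have B: "finite B" using less.prems A by simp
    let ?n = "card B"
    let ?h = "\<lambda>k. fact k * fps_nth G k * (fact (?n - k) * fps_nth F (?n - k))"
    have "real (card (assemblies K supp A)) =
      (\<Sum>S\<in>Pow B. real (card {c\<in>K. supp c = insert a S}) * real (card (assemblies K supp (B - S))))"
      unfolding A by (simp add: card_assemblies_insert[OF B aB ne fin])
    also have "\<dots> = (\<Sum>S\<in>Pow B. ?h (card S))"
    proof (rule sum.cong[OF refl])
      fix S assume "S \<in> Pow B"
      then have S: "S \<subseteq> B" "finite S" "a \<notin> S" using B aB by (auto intro: finite_subset)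
      have "card (B - S) = ?n - card S" using S by (simp add: card_Diff_subset)
      moreover have "real (card (assemblies K supp (B - S))) = fact (card (B - S)) * fps_nth F (card (B - S))"
        using B aB A calculation by (intro less.hyps) auto
      ultimately show "real (card {c\<in>K. supp c = insert a S}) * real (card (assemblies K supp (B - S))) = ?h (card S)"
        using comp[OF S(2,3)] by simp
    qed
    also have "\<dots> = (\<Sum>k=0..?n. real (?n choose k) * ?h k)"
      by (rule sum_Pow_card[OF B])
    also have "\<dots> = (\<Sum>k=0..?n. fact ?n * (fps_nth G k * fps_nth F (?n - k)))"
    proof (rule sum.cong[OF refl])
      fix k assume "k \<in> {0..?n}"
      then have "real (?n choose k) = fact ?n / (fact k * fact (?n - k))"
        by (simp add: binomial_fact)
      then show "real (?n choose k) * ?h k = fact ?n * (fps_nth G k * fps_nth F (?n - k))"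
        by simp
    qed
    also have "\<dots> = fact ?n * fps_nth (G * F) ?n"
      by (simp add: fps_mult_nth sum_distrib_left)
    also have "fps_nth (G * F) ?n = real (Suc ?n) * fps_nth F (Suc ?n)"
      by (simp add: mult.commute[of G F] flip: ode)
    finally show ?thesis using A aB B by (simp add: algebra_simps)
  qed
qed

section \<open>Components\<close>

text \<open>Such a partition is determined by the remaining elements \<open>T\<close> of the block of \<open>a\<close>, and \<open>T\<close> may
  be any subset of \<open>S\<close>. For \<open>T = S\<close> the second block is empty and is dropped, which is the
  partition with one block.\<close>

lemma card_partitions_into_one_or_two:
  assumes "finite S" "a \<notin> S"
  shows "card {E. partition_on (insert a S) E \<and> card E \<in> {1, 2}} = 2 ^ card S"
proof -
  let ?g = "\<lambda>T. {insert a T, S - T} - {{}}"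
  have "bij_betw ?g (Pow S) {E. partition_on (insert a S) E \<and> card E \<in> {1, 2}}"
  proof (rule bij_betw_imageI)
    have "T = T'" if "T \<subseteq> S" "T' \<subseteq> S" "?g T = ?g T'" for T T'
    proof -
      have "insert a T \<in> ?g T" by blast
      then have "insert a T \<in> ?g T'" unfolding that(3) .
      then have "insert a T = insert a T'" using assms(2) by blast
      then show ?thesis using that(1,2) assms(2) by (metis insert_ident subsetD)
    qed
    then show "inj_on ?g (Pow S)" by (intro inj_onI) auto
  next
    show "?g ` Pow S = {E. partition_on (insert a S) E \<and> card E \<in> {1, 2}}"
    proof (rule equalityI; rule subsetI)
      fix E assume "E \<in> ?g ` Pow S"
      then obtain T where T: "T \<subseteq> S" "E = ?g T" by auto
      show "E \<in> {E. partition_on (insert a S) E \<and> card E \<in> {1, 2}}"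
      proof (cases "T = S")
        case True
        then have "E = {insert a S}" using T(2) by auto
        then show ?thesis by (simp add: partition_on_def)
      next
        case False
        then have E: "E = {insert a T, S - T}" and "S - T \<noteq> {}" using T by auto
        moreover have "insert a T \<noteq> S - T" using assms(2) by auto
        ultimately have "card E = 2" by simp
        moreover have "partition_on (insert a S) E"
          using E \<open>S - T \<noteq> {}\<close> T(1) assms(2) by (auto simp: partition_on_def disjoint_def)
        ultimately show ?thesis by simp
      qed
    next
      fix E assume E: "E \<in> {E. partition_on (insert a S) E \<and> card E \<in> {1, 2}}"
      then obtain X where X: "X \<in> E" "a \<in> X" by (auto simp: partition_on_def)
      have sub: "\<Union>E = insert a S" and n0: "{} \<notin> E" and dj: "disjoint E"
        using E by (auto simp: partition_on_def)
      have XT: "insert a (X - {a}) = X" using X by auto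
      obtain Y where Y: "E = {X} \<or> (E = {X, Y} \<and> X \<noteq> Y)"
      proof -
        have "card E = 1 \<or> card E = 2" using E by auto
        then show ?thesis
        proof
          assume "card E = 1"
          then show ?thesis using that X(1) by (metis card_1_singletonE singletonD)
        next
          assume "card E = 2"
          then show ?thesis using that X(1) by (metis card_2_iff doubleton_eq_iff insertE singletonD)
        qed
      qed
      have "E = ?g (X - {a})"
      proof (cases "E = {X}")
        case True
        then have "S - (X - {a}) = {}" using sub assms(2) by auto
        then show ?thesis using True XT by auto
      next
        case False
        then have EY: "E = {X, Y}" "X \<noteq> Y" using Y by auto
        then have "X \<inter> Y = {}" using dj by (auto simp: disjoint_def)
        then have "Y = S - (X - {a})" using sub EY(1) X assms(2) by auto
        then show ?thesis using EY XT n0 X by auto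
      qed
      moreover have "X - {a} \<in> Pow S" using X sub by auto
      ultimately show "E \<in> ?g ` Pow S" by (rule image_eqI)
    qed
  qed
  then show ?thesis using assms by (simp add: bij_betw_same_card[symmetric] card_Pow)
qed

text \<open>In a component \<open>(E, p)\<close> the set \<open>E\<close> holds the one or two subsets, rather than only
  their union, and \<open>p\<close> is their common place. Edges join only subsets in the same section, so a
  distinguished place admits only one-element \<open>E\<close>.\<close>

definition components :: "nat \<Rightarrow> nat \<Rightarrow> (nat set set \<times> place) set" where
  "components r l = {(E, p). partition_on (\<Union>E) E \<and>
     (p \<in> Section ` {1..l} \<and> card E \<in> {1, 2} \<or>
      p \<in> Distinguished ` distinguished_blocks r \<and> card E = 1)}"

abbreviation support :: "nat set set \<times> place \<Rightarrow> nat set" where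
  "support c \<equiv> \<Union>(fst c)"

lemma support_nonempty:
  assumes "c \<in> components r l"
  shows "support c \<noteq> {}"
proof -
  have "fst c \<noteq> {}" and n0: "{} \<notin> fst c"
    using assms by (auto simp: components_def partition_on_def)
  then obtain X where "X \<in> fst c" by auto
  with n0 show ?thesis by (metis Union_empty_conv)
qed

lemma card_components:
  assumes "finite S" "a \<notin> S"
  shows "finite {c \<in> components r l. support c = insert a S}"
    and "card {c \<in> components r l. support c = insert a S} = r + l * 2 ^ card S"
proof -
  let ?E = "{E. partition_on (insert a S) E \<and> card E \<in> {1, 2}}"
  let ?X = "{{insert a S}} \<times> Distinguished ` distinguished_blocks r"
  let ?Y = "?E \<times> Section ` {1..l}"
  have eq: "{c \<in> components r l. support c = insert a S} = ?X \<union> ?Y"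
  proof (rule set_eqI)
    fix c :: "nat set set \<times> place"
    obtain E p where c: "c = (E, p)" by (cases c)
    have one: "E = {insert a S} \<longleftrightarrow> partition_on (insert a S) E \<and> card E = 1"
      by (auto simp: partition_on_def card_1_singleton_iff)
    have "\<Union>E = insert a S \<and> partition_on (\<Union>E) E \<longleftrightarrow> partition_on (insert a S) E"
      by (auto simp: partition_on_def)
    then show "c \<in> {c \<in> components r l. support c = insert a S} \<longleftrightarrow> c \<in> ?X \<union> ?Y"
      unfolding c components_def Un_iff mem_Times_iff fst_conv snd_conv singleton_iff one mem_Collect_eq
        case_prod_conv
      by blast
  qed
  have fE: "finite ?E"
    using assms(1) card_partitions_into_one_or_two[OF assms] by (intro card_ge_0_finite) simp
  then show "finite {c \<in> components r l. support c = insert a S}"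
    unfolding eq by (simp add: distinguished_blocks_def)
  have "card (?X \<union> ?Y) = card ?X + card ?Y"
    using fE by (intro card_Un_disjoint) (auto simp: distinguished_blocks_def)
  also have "card ?X = r"
    by (auto simp: card_cartesian_product distinguished_blocks_def card_image inj_on_def)
  also have "card ?Y = l * 2 ^ card S"
    using card_partitions_into_one_or_two[OF assms]
    by (auto simp: card_cartesian_product card_image inj_on_def)
  finally show "card {c \<in> components r l. support c = insert a S} = r + l * 2 ^ card S"
    unfolding eq .
qed

lemma finite_components:
  assumes "finite S"
  shows "finite {c \<in> components r l. support c = S}"
proof (cases "S = {}")
  case True
  then have "{c \<in> components r l. support c = S} = {}" using support_nonempty by blast
  then show ?thesis by (metis finite.emptyI)
next
  case False
  then obtain a where "a \<in> S" by blast
  then show ?thesis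
    using card_components(1)[of "S - {a}" a r l] assms by (simp add: insert_absorb)
qed

section \<open>Configurations as assemblies of components\<close>

text \<open>A subset \<open>X\<close> in no edge of the matching contributes the component with \<open>E = {X}\<close>.
  The place \<open>p\<close> is determined by \<open>E\<close>, because \<open>E\<close> is non-empty and \<open>f\<close> is constant on it.\<close>

definition components_of ::
    "nat set set \<times> (nat set \<Rightarrow> place) \<times> nat set set set \<Rightarrow> (nat set set \<times> place) set" where
  "components_of = (\<lambda>(P, f, M).
     {(E, p). E \<in> M \<union> (\<lambda>X. {X}) ` (P - \<Union>M) \<and> (\<forall>X\<in>E. f X = p)})"

text \<open>The edges and the unmatched subsets form a partition \<open>U\<close> of \<open>P\<close>. The triple
  \<open>(P, f, M)\<close> can be recovered from its components: \<open>U\<close> is the set of first entries, \<open>P\<close> is the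
  union of \<open>U\<close>, the edges are the two-element members of \<open>U\<close>, and \<open>f\<close> is given by
  the second entries.\<close>

lemma configuration_properties:
  fixes P f M
  defines "U \<equiv> M \<union> (\<lambda>X. {X}) ` (P - \<Union>M)"
  assumes c: "(P, f, M) \<in> configurations n r l"
  shows "partition_on P U"
    and "M = {E \<in> U. card E = 2}"
    and "\<And>E X. E \<in> U \<Longrightarrow> X \<in> E \<Longrightarrow> (E, f X) \<in> components_of (P, f, M)"
    and "fst ` components_of (P, f, M) = U"
    and "components_of (P, f, M) \<subseteq> components r l"
proof -
  have P: "partition_on {r+1..n+r} P" and f: "f \<in> P \<rightarrow>\<^sub>E places r l"
    and M: "\<And>E. E \<in> M \<Longrightarrow> E \<subseteq> P" "\<And>E. E \<in> M \<Longrightarrow> card E = 2"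
      "\<And>E. E \<in> M \<Longrightarrow> \<exists>s\<in>{1..l}. \<forall>X\<in>E. f X = Section s" and dM: "disjoint M"
    using c by (auto simp: configurations_def section_matching_def)
  have nM: "{} \<notin> M" using M(2) by fastforce
  show U: "partition_on P U"
  proof (rule partition_onI)
    show "\<Union>U = P" unfolding U_def using M(1) by blast
    show "{} \<notin> U" unfolding U_def using nM by blast
    show "disjnt E E'" if "E \<in> U" "E' \<in> U" "E \<noteq> E'" for E E'
      using that dM unfolding U_def pairwise_def by (auto simp: disjnt_def)
  qed
  show "M = {E \<in> U. card E = 2}" unfolding U_def using M(2) by auto
  show mem: "(E, f X) \<in> components_of (P, f, M)" if "E \<in> U" "X \<in> E" for E X
    using that M(3) unfolding U_def components_of_def by fastforce
  show "fst ` components_of (P, f, M) = U"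
  proof
    show "fst ` components_of (P, f, M) \<subseteq> U" unfolding components_of_def U_def by auto
    show "U \<subseteq> fst ` components_of (P, f, M)"
    proof
      fix E assume E: "E \<in> U"
      then obtain X where "X \<in> E" using U unfolding partition_on_def by fastforce
      then show "E \<in> fst ` components_of (P, f, M)" using mem[OF E] by force
    qed
  qed
  show "components_of (P, f, M) \<subseteq> components r l"
  proof
    fix c assume "c \<in> components_of (P, f, M)"
    then obtain E p where c: "c = (E, p)" and E: "E \<in> U" and p: "\<And>X. X \<in> E \<Longrightarrow> f X = p"
      unfolding components_of_def U_def by auto
    have "E \<subseteq> P" using U E unfolding partition_on_def by auto
    then have part: "partition_on (\<Union>E) E"
      using P unfolding partition_on_def pairwise_def by blast
    consider "E \<in> M" | X where "E = {X}" "X \<in> P" using E unfolding U_def by auto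
    then show "c \<in> components r l"
    proof cases
      case 1
      obtain X where "X \<in> E" using 1 nM by fastforce
      then have "p \<in> Section ` {1..l}" using M(3)[OF 1] p by fastforce
      then show ?thesis using part M(2)[OF 1] unfolding c components_def by auto
    next
      case 2
      then have "p \<in> places r l" using f p by auto
      then show ?thesis using part 2 unfolding c components_def places_def by auto
    qed
  qed
qed

text \<open>Injectivity is the recovery described above. For surjectivity the same recipe turns
  an arbitrary assembly into a configuration. It works because two components containing
  overlapping subsets coincide, which makes the place of each subset well defined and the edges
  disjoint.\<close>

lemma components_of_bij_betw:
  "bij_betw components_of (configurations n r l) (assemblies (components r l) support {r+1..n+r})"
proof (rule bij_betw_imageI)
  show "inj_on components_of (configurations n r l)"
  proof (rule inj_onI)
    fix x y
    assume xy: "x \<in> configurations n r l" "y \<in> configurations n r l"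
      "components_of x = components_of y"
    obtain P f M P' f' M' where x: "x = (P, f, M)" and y: "y = (P', f', M')"
      by (cases x; cases y) auto
    have c: "(P, f, M) \<in> configurations n r l" and c': "(P', f', M') \<in> configurations n r l"
      and eq: "components_of (P, f, M) = components_of (P', f', M')"
      using xy unfolding x y by blast+
    note a = configuration_properties[OF c] and a' = configuration_properties[OF c']
    have U: "M \<union> (\<lambda>X. {X}) ` (P - \<Union>M) = M' \<union> (\<lambda>X. {X}) ` (P' - \<Union>M')"
      using a(4) a'(4) eq by simp
    have P: "P = P'" using a(1) a'(1) U by (metis partition_onD1)
    have M: "M = M'" using a(2) a'(2) U by metis
    have "f X = f' X" if XP: "X \<in> P" for X
    proof -
      obtain E where E: "X \<in> E" "E \<in> M \<union> (\<lambda>X. {X}) ` (P - \<Union>M)"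
        using subsetD[OF equalityD1[OF partition_onD1[OF a(1)]] XP] by (rule UnionE)
      then have "(E, f X) \<in> components_of (P', f', M')" using a(3) eq by metis
      then show ?thesis using E(1) unfolding components_of_def by auto
    qed
    moreover have "f \<in> P \<rightarrow>\<^sub>E places r l" "f' \<in> P \<rightarrow>\<^sub>E places r l"
      using c c' P unfolding configurations_def by auto
    ultimately have "f = f'" by (intro PiE_ext) auto
    then show "x = y" unfolding x y using P M by simp
  qed
next
  show "components_of ` configurations n r l = assemblies (components r l) support {r+1..n+r}"
  proof (rule equalityI; rule subsetI)
    fix C assume "C \<in> components_of ` configurations n r l"
    then obtain P f M where c: "(P, f, M) \<in> configurations n r l" and C: "C = components_of (P, f, M)"
      by auto
    note a = configuration_properties[OF c, folded C]
    have P: "partition_on {r+1..n+r} P" using c by (simp add: configurations_def)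
    have "disjoint_family_on support C"
      unfolding disjoint_family_on_def
    proof (intro ballI impI)
      fix c d assume cd: "c \<in> C" "d \<in> C" "c \<noteq> d"
      obtain E p E' p' where e: "c = (E, p)" "d = (E', p')" by (cases c; cases d)
      have U: "E \<in> M \<union> (\<lambda>X. {X}) ` (P - \<Union>M)" "E' \<in> M \<union> (\<lambda>X. {X}) ` (P - \<Union>M)"
        using imageI[OF cd(1), of fst] imageI[OF cd(2), of fst] unfolding a(4) e by simp_all
      have p: "f X = p" if "X \<in> E" for X
        using cd(1) that unfolding C e components_of_def by auto
      have p': "f X = p'" if "X \<in> E'" for X
        using cd(2) that unfolding C e components_of_def by auto
      have "E \<noteq> {}" using U(1) a(1) unfolding partition_on_def by blast
      then have "E \<noteq> E'" using p p' cd(3) e by auto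
      then have "E \<inter> E' = {}" "E \<subseteq> P" "E' \<subseteq> P"
        using U a(1) unfolding partition_on_def disjoint_def by blast+
      then have "X \<inter> Y = {}" if "X \<in> E" "Y \<in> E'" for X Y
        using that P by (intro disjointD[OF partition_onD2[OF P]]) auto
      then show "support c \<inter> support d = {}"
        unfolding e by fastforce
    qed
    moreover have "(\<Union>c\<in>C. support c) = \<Union>(\<Union>(fst ` C))" by blast
    moreover have "\<dots> = {r+1..n+r}"
      using a(1,4) P by (simp add: partition_on_def)
    ultimately show "C \<in> assemblies (components r l) support {r+1..n+r}"
      using a(5) unfolding assemblies_def by simp
  next
    fix C assume "C \<in> assemblies (components r l) support {r+1..n+r}"
    then have CK: "C \<subseteq> components r l" and dj: "disjoint_family_on support C"
      and cover: "(\<Union>c\<in>C. support c) = {r+1..n+r}"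
      unfolding assemblies_def by auto
    have K: "partition_on (\<Union>E) E"
        "p \<in> Section ` {1..l} \<and> card E \<in> {1, 2} \<or>
          p \<in> Distinguished ` distinguished_blocks r \<and> card E = 1"
      if "(E, p) \<in> C" for E p
      using that CK unfolding components_def by auto
    have n0: "X \<noteq> {}" if "(E, p) \<in> C" "X \<in> E" for E p X
      using K(1)[OF that(1)] that(2) unfolding partition_on_def by blast
    have same: "E = E' \<and> p = p'"
      if "(E, p) \<in> C" "(E', p') \<in> C" "X \<in> E" "Y \<in> E'" "X \<inter> Y \<noteq> {}" for E p E' p' X Y
    proof (rule ccontr)
      assume "\<not> (E = E' \<and> p = p')"
      then have "\<Union>E \<inter> \<Union>E' = {}" using disjoint_family_onD[OF dj that(1,2)] by auto
      then show False using that(3-5) by blast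
    qed
    define P where "P = \<Union>(fst ` C)"
    define M where "M = {E \<in> fst ` C. card E = 2}"
    define f where "f = restrict (\<lambda>X. SOME p. \<exists>E. (E, p) \<in> C \<and> X \<in> E) P"
    have f: "f X = p" if "(E, p) \<in> C" "X \<in> E" for E p X
    proof -
      have "X \<in> P" using that unfolding P_def by force
      moreover have "(SOME p. \<exists>E. (E, p) \<in> C \<and> X \<in> E) = p"
        using that same n0 by (intro some_equality) (blast, metis inf.idem)
      ultimately show ?thesis unfolding f_def by simp
    qed
    have PE: "\<exists>E p. (E, p) \<in> C \<and> X \<in> E" if "X \<in> P" for X
      using that unfolding P_def by auto
    have "partition_on {r+1..n+r} P"
    proof (rule partition_onI)
      show "\<Union>P = {r+1..n+r}" unfolding P_def cover[symmetric] by blast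
      show "{} \<notin> P" using PE n0 by blast
      show "disjnt X Y" if XY: "X \<in> P" "Y \<in> P" "X \<noteq> Y" for X Y
      proof (rule ccontr)
        assume nd: "\<not> disjnt X Y"
        obtain E p E' p' where E: "(E, p) \<in> C" "X \<in> E" "(E', p') \<in> C" "Y \<in> E'"
          using PE XY by meson
        then have "E = E'" using same nd unfolding disjnt_def by blast
        then show False
          using K(1)[OF E(1)] E nd XY(3) unfolding partition_on_def pairwise_def by blast
      qed
    qed
    moreover have "f \<in> P \<rightarrow>\<^sub>E places r l"
    proof (rule PiE_I)
      fix X assume "X \<in> P"
      then obtain E p where E: "(E, p) \<in> C" "X \<in> E" using PE by blast
      then show "f X \<in> places r l" using K(2)[OF E(1)] f[OF E] unfolding places_def by auto
    qed (simp add: f_def)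
    moreover have "section_matching l P f M"
      unfolding section_matching_def
    proof (intro conjI ballI)
      fix E assume "E \<in> M"
      then obtain p where E: "(E, p) \<in> C" "card E = 2" unfolding M_def by auto
      show "E \<subseteq> P" using E(1) unfolding P_def by force
      show "card E = 2" by fact
      obtain s where "s \<in> {1..l}" "p = Section s" using K(2)[OF E(1)] E(2) by auto
      then show "\<exists>s\<in>{1..l}. \<forall>X\<in>E. f X = Section s" using f[OF E(1)] by blast
    next
      show "disjoint M"
      proof (rule disjointI, rule ccontr)
        fix E E' assume E: "E \<in> M" "E' \<in> M" "E \<noteq> E'" "E \<inter> E' \<noteq> {}"
        then obtain p p' X where X: "(E, p) \<in> C" "(E', p') \<in> C" "X \<in> E" "X \<in> E'"
          unfolding M_def by auto
        then show False using same[OF X] n0[OF X(1,3)] E(3) by auto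
      qed
    qed
    ultimately have "(P, f, M) \<in> configurations n r l" by (simp add: configurations_def)
    moreover have "C = components_of (P, f, M)"
    proof -
      have U: "M \<union> (\<lambda>X. {X}) ` (P - \<Union>M) = fst ` C"
      proof (rule equalityI; rule subsetI)
        fix E assume "E \<in> M \<union> (\<lambda>X. {X}) ` (P - \<Union>M)"
        then consider "E \<in> M" | X where "E = {X}" "X \<in> P" "X \<notin> \<Union>M" by auto
        then show "E \<in> fst ` C"
        proof cases
          case 1
          then show ?thesis unfolding M_def by simp
        next
          case 2
          then obtain E' p where E': "(E', p) \<in> C" "X \<in> E'" using PE by blast
          then have "E' \<notin> M" using 2(3) by auto
          then have "card E' \<noteq> 2" using E'(1) unfolding M_def by force
          then have "card E' = 1" using K(2)[OF E'(1)] by auto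
          then have "E' = E" using E'(2) 2(1) by (metis card_1_singletonE singletonD)
          then show ?thesis using E'(1) by force
        qed
      next
        fix E assume EC: "E \<in> fst ` C"
        then obtain p where E: "(E, p) \<in> C" by auto
        show "E \<in> M \<union> (\<lambda>X. {X}) ` (P - \<Union>M)"
        proof (cases "card E = 2")
          case True
          then show ?thesis using EC unfolding M_def by blast
        next
          case False
          then have "card E = 1" using K(2)[OF E] by auto
          then obtain X where X: "E = {X}" by (rule card_1_singletonE)
          have "X \<notin> E'" if EM: "E' \<in> M" for E'
          proof
            assume "X \<in> E'"
            obtain p' where "(E', p') \<in> C" using EM unfolding M_def by auto
            then have "E = E'" using same[OF E, of E' p' X X] n0[OF E] X \<open>X \<in> E'\<close> by auto
            then show False using EM False unfolding M_def by simp
          qed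
          then have "X \<notin> \<Union>M" by auto
          moreover have "X \<in> P" using E X unfolding P_def by force
          ultimately have "X \<in> P - \<Union>M" by simp
          then show ?thesis unfolding X by (intro UnI2 imageI)
        qed
      qed
      have comps: "components_of (P, f, M) = {(E, p). E \<in> fst ` C \<and> (\<forall>X\<in>E. f X = p)}"
        by (simp only: components_of_def prod.case U)
      show ?thesis
      proof (rule equalityI; rule subsetI)
        fix c assume "c \<in> C"
        then show "c \<in> components_of (P, f, M)"
          unfolding comps using f by (cases c) force
      next
        fix c assume "c \<in> components_of (P, f, M)"
        then obtain E p where c: "c = (E, p)" "E \<in> fst ` C" "\<And>X. X \<in> E \<Longrightarrow> f X = p"
          unfolding comps by auto
        then obtain p' where E: "(E, p') \<in> C" by auto
        then obtain X where "X \<in> E" using K(2)[OF E] by fastforce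
        then have "p = p'" using f[OF E] c(3) by auto
        then show "c \<in> C" using c(1) E by simp
      qed
    qed
    ultimately show "C \<in> components_of ` configurations n r l" by blast
  qed
qed

section \<open>Generating functions\<close>

lemma fps_deriv_exp_of_exp:
  "fps_deriv (fps_exp 1 oo (fps_const x * (fps_exp a - 1))) =
    (fps_exp 1 oo (fps_const x * (fps_exp a - 1))) * (fps_const (x * a) * fps_exp (a :: real))"
  by (subst fps_compose_deriv) (simp_all add: mult.assoc flip: fps_const_mult)

theorem theorem5p3:
  fixes n r l :: nat
  assumes "l \<ge> 1"
  shows "real (T_count n r l) = (\<Sum>k=0..n. real (n choose k) * B0 r k * D20 (real l) (n - k))"
proof -
  define F where "F = B0_egf r * D20_egf (real l)"
  define G where "G = fps_const (real r) * fps_exp 1 + fps_const (real l) * fps_exp (2 :: real)"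
  have F0: "fps_nth F 0 = 1"
    by (simp add: F_def B0_egf_def D20_egf_def)
  have ode: "fps_deriv F = F * G"
  proof -
    have "fps_deriv (B0_egf r) = B0_egf r * (fps_const (real r) * fps_exp 1)"
      using fps_deriv_exp_of_exp[of "real r" 1] by (simp add: B0_egf_def)
    moreover have "fps_deriv (D20_egf (real l)) = D20_egf (real l) * (fps_const (real l) * fps_exp 2)"
      using fps_deriv_exp_of_exp[of "real l / 2" 2] by (simp add: D20_egf_def)
    ultimately show ?thesis by (simp add: F_def G_def algebra_simps)
  qed
  have comp: "real (card {c \<in> components r l. support c = insert a S}) =
      fact (card S) * fps_nth G (card S)"
    if "finite S" "a \<notin> S" for a S
    using card_components(2)[OF that] by (simp add: G_def field_simps)
  have "real (T_count n r l) = real (card (assemblies (components r l) support {r+1..n+r}))"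
    using bij_betw_same_card[OF components_of_bij_betw] by (simp add: T_count_def)
  also have "\<dots> = fact n * fps_nth F n"
    using exponential_formula[where F = F and G = G and A = "{r+1..n+r}" and supp = support,
        OF _ support_nonempty finite_components comp F0 ode]
    by simp
  also have "\<dots> = (\<Sum>k=0..n. real (n choose k) * B0 r k * D20 (real l) (n - k))"
    unfolding F_def fps_mult_nth sum_distrib_left
    by (intro sum.cong) (simp_all add: B0_def D20_def binomial_fact)
  finally show ?thesis .
qed

end
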